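(* Let $(X,X_0,x_0,\rho_0,R_0,(\mu_x^U))$ be data as described in the context. Suppose that (J$_0$) there are $\alpha,\delta_0\in(0,1)$ such that $\mu_{x_0}^{U_{\alpha r}}(U_r)>\delta_0$ for every $0<r<R_0$; (HI) there exist $\alpha\in(0,1)$ and $K\ge1$ such that $\sup h(U_{\alpha r})\le K\inf h(U_{\alpha r})$ for all $0<r<R_0$ and all $h\in\mathcal H_b^+(U_r)$ (the numbers $\alpha$ in (J$_0$) and (HI) need not be the same). Then (HC) holds: there exist $C>0$ and $\beta\in(0,1)$ such that, for all $0<r<R_0$, all $h\in\mathcal H_b(U_r)$ and all $x\in U_r$, $$|h(x)-h(x_0)|\le C\,\|h\|_\infty\left(\frac{\rho_0(x)}{r}\right)^\beta .$$
   Context: Setting. $X$ is a topological space such that every finite measure $\mu$ on its Borel $\sigma$-algebra $\mathcal B(X)$ satisfies $\mu(A)=\sup\{\mu(F): F \text{ closed}, F\subset A\}$ for all $A\in\mathcal B(X)$. Finite Borel measures are also considered as measures on the $\sigma$-algebra of universally measurable sets. $X_0$ is an open neighborhood of a point $x_0\in X$, $\rho_0\ge 0$ is a continuous real function on $X_0$ with $\rho_0(x_0)=0$, and $0<R_0\le\infty$ is such that for every $0<r<R_0$ the closure of $$U_r:=\{x\in X_0:\rho_0(x)<r\}$$ is contained in $X_0$. Let $\mathcal U_0$ be the set of all open $V\subset X$ with $V\subset U_r$ for some $0<r<R_0$. There are given finite Borel measures $\mu_x^U$ on $X$, for $x\in X$, $U\in\mathcal U_0$, such that for all $x\in X$ and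 $U,V\in\mathcal U_0$: (i) $\mu_x^U$ is supported by $U^c$ (i.e. $\mu_x^U(U)=0$), $\mu_x^U(X)=1$, and $\mu_x^U=\varepsilon_x$ (Dirac measure at $x$) if $x\in U^c$; (ii) for each $E\in\mathcal B(X)$ the function $y\mapsto\mu_y^U(E)$ is universally measurable, and if $V\subset U$, then $\mu_x^U=\int\mu_y^U\,d\mu_x^V(y)$. Harmonic functions. For $U\in\mathcal U_0$, $\mathcal H(U)$ is the set of all universally measurable real functions $h$ on $X$ such that, for all open $V$ with $\overline V\subset U$ and all $x\in V$, $h$ is $\mu_x^V$-integrable and $\int h\,d\mu_x^V=h(x)$. $\mathcal H_b(U)$ is the set of bounded functions in $\mathcal H(U)$, and $\mathcal H_b^+(U)$ the set of those $h\in\mathcal H_b(U)$ with $h\ge0$ on $X$; $\|h\|_\infty=\sup_X|h|$. *)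

theory Defs
  imports "HOL-Probability.Probability"
begin

definition finite_borel_measure :: "'a::topological_space measure \<Rightarrow> bool" where
  "finite_borel_measure M \<longleftrightarrow> sets M = sets borel \<and> finite_measure M"

definition universally_measurable_sets :: "'a::topological_space set set" where
  "universally_measurable_sets = {A. \<forall>M. finite_borel_measure M \<longrightarrow> A \<in> sets (completion M)}"

text \<open>Only the \<open>\<sigma>\<close>-algebra of this measure space matters; its measure is the zero measure.\<close>

definition univ_borel :: "'a::topological_space measure" where
  "univ_borel = sigma UNIV universally_measurable_sets"

lemma space_univ_borel [simp]: "space univ_borel = UNIV"
  by (simp add: univ_borel_def space_measure_of_conv)

lemma sigma_algebra_universally_measurable_sets:
  "sigma_algebra UNIV (universally_measurable_sets :: 'a::topological_space set set)"
proof -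
  have sp: "space (completion M) = UNIV" if "finite_borel_measure M" for M :: "'a measure"
    using that sets_eq_imp_space_eq[of M borel] by (auto simp: finite_borel_measure_def)
  show ?thesis
    unfolding sigma_algebra_iff2 universally_measurable_sets_def
  proof (safe, simp_all)
    fix A :: "'a set" and M :: "'a measure"
    assume A: "\<forall>M. finite_borel_measure M \<longrightarrow> A \<in> sets (completion M)" and M: "finite_borel_measure M"
    show "UNIV - A \<in> sets (completion M)"
      using sets.compl_sets[of A "completion M"] A M sp[OF M] by simp
  next
    fix A :: "nat \<Rightarrow> 'a set" and M :: "'a measure"
    assume "range A \<subseteq> {A. \<forall>M. finite_borel_measure M \<longrightarrow> A \<in> sets (completion M)}"
      and "finite_borel_measure M"
    then show "(\<Union>i. A i) \<in> sets (completion M)"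
      by (intro sets.countable_UN) blast
  qed
qed

lemma sets_univ_borel: "sets univ_borel = universally_measurable_sets"
  unfolding univ_borel_def
  by (intro sigma_algebra.sets_measure_of_eq sigma_algebra_universally_measurable_sets)

text \<open>A finite Borel measure considered as a measure on the universally measurable sets.\<close>

definition univ_ext :: "'a::topological_space measure \<Rightarrow> 'a measure" where
  "univ_ext M = restr_to_subalg (completion M) univ_borel"

lemma subalgebra_univ_borel:
  assumes "finite_borel_measure M"
  shows "subalgebra (completion M) univ_borel"
  using assms sets_eq_imp_space_eq[of M borel]
  by (auto simp: subalgebra_def sets_univ_borel universally_measurable_sets_def
      finite_borel_measure_def)

lemma sets_univ_ext:
  "finite_borel_measure M \<Longrightarrow> sets (univ_ext M) = universally_measurable_sets"
  unfolding univ_ext_def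
  by (simp add: sets_restr_to_subalg[OF subalgebra_univ_borel] sets_univ_borel)

lemma emeasure_univ_ext_borel:
  assumes "finite_borel_measure M" "A \<in> sets borel"
  shows "emeasure (univ_ext M) A = emeasure M A"
proof -
  have "A \<in> sets univ_borel"
    using assms(2) by (auto simp: sets_univ_borel universally_measurable_sets_def
        finite_borel_measure_def intro: sets_completionI_sets)
  then show ?thesis
    using assms by (simp add: univ_ext_def emeasure_restr_to_subalg[OF subalgebra_univ_borel]
        finite_borel_measure_def)
qed

definition sublevel :: "'a set \<Rightarrow> ('a \<Rightarrow> real) \<Rightarrow> real \<Rightarrow> 'a set" where
  "sublevel X0 \<rho> r = {x \<in> X0. \<rho> x < r}"

definition local_open_sets :: "'a::topological_space set \<Rightarrow> ('a \<Rightarrow> real) \<Rightarrow> ereal \<Rightarrow> 'a set set" where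
  "local_open_sets X0 \<rho> R =
     {V. open V \<and> (\<exists>r. 0 < r \<and> ereal r < R \<and> V \<subseteq> sublevel X0 \<rho> r)}"

text \<open>\<open>\<mu> U x\<close> is the measure $\mu_x^U$; it is constrained only for \<open>U \<in> local_open_sets X0 \<rho> R\<close>.
  Likewise, \<open>\<rho>\<close> is constrained only on \<open>X0\<close>.\<close>

locale exit_measures =
  fixes X0 :: "'a::topological_space set"
    and x0 :: 'a
    and \<rho> :: "'a \<Rightarrow> real"
    and R :: ereal
    and \<mu> :: "'a set \<Rightarrow> 'a \<Rightarrow> 'a measure"
  assumes inner_regular:
      "\<And>(M :: 'a measure) A. finite_borel_measure M \<Longrightarrow> A \<in> sets borel \<Longrightarrow>
         emeasure M A = (SUP F\<in>{F. closed F \<and> F \<subseteq> A}. emeasure M F)"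
    and open_X0: "open X0"
    and x0_in: "x0 \<in> X0"
    and continuous_\<rho>: "continuous_on X0 \<rho>"
    and \<rho>_nonneg: "\<And>x. x \<in> X0 \<Longrightarrow> 0 \<le> \<rho> x"
    and \<rho>_x0: "\<rho> x0 = 0"
    and R_pos: "0 < R"
    and closure_sublevel:
      "\<And>r. 0 < r \<Longrightarrow> ereal r < R \<Longrightarrow> closure (sublevel X0 \<rho> r) \<subseteq> X0"
    and finite_borel:
      "\<And>U x. U \<in> local_open_sets X0 \<rho> R \<Longrightarrow> finite_borel_measure (\<mu> U x)"
    and null_on: "\<And>U x. U \<in> local_open_sets X0 \<rho> R \<Longrightarrow> emeasure (\<mu> U x) U = 0"
    and total_mass: "\<And>U x. U \<in> local_open_sets X0 \<rho> R \<Longrightarrow> emeasure (\<mu> U x) UNIV = 1"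
    and dirac_outside:
      "\<And>U x. U \<in> local_open_sets X0 \<rho> R \<Longrightarrow> x \<notin> U \<Longrightarrow> \<mu> U x = return borel x"
    and universally_measurable_kernel:
      "\<And>U E. U \<in> local_open_sets X0 \<rho> R \<Longrightarrow> E \<in> sets borel \<Longrightarrow>
         (\<lambda>y. emeasure (\<mu> U y) E) \<in> borel_measurable univ_borel"
    and iterated:
      "\<And>U V x E. U \<in> local_open_sets X0 \<rho> R \<Longrightarrow> V \<in> local_open_sets X0 \<rho> R \<Longrightarrow> V \<subseteq> U \<Longrightarrow>
         E \<in> sets borel \<Longrightarrow>
         emeasure (\<mu> U x) E = (\<integral>\<^sup>+ y. emeasure (\<mu> U y) E \<partial>univ_ext (\<mu> V x))"

definition harmonic ::
    "('a::topological_space set \<Rightarrow> 'a \<Rightarrow> 'a measure) \<Rightarrow> 'a set \<Rightarrow> ('a \<Rightarrow> real) set" where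
  "harmonic \<mu> U = {h \<in> borel_measurable univ_borel.
     \<forall>V x. open V \<longrightarrow> closure V \<subseteq> U \<longrightarrow> x \<in> V \<longrightarrow>
       integrable (univ_ext (\<mu> V x)) h \<and> (\<integral>y. h y \<partial>univ_ext (\<mu> V x)) = h x}"

definition bounded_harmonic ::
    "('a::topological_space set \<Rightarrow> 'a \<Rightarrow> 'a measure) \<Rightarrow> 'a set \<Rightarrow> ('a \<Rightarrow> real) set" where
  "bounded_harmonic \<mu> U = {h \<in> harmonic \<mu> U. bounded (range h)}"

definition pos_bounded_harmonic ::
    "('a::topological_space set \<Rightarrow> 'a \<Rightarrow> 'a measure) \<Rightarrow> 'a set \<Rightarrow> ('a \<Rightarrow> real) set" where
  "pos_bounded_harmonic \<mu> U = {h \<in> bounded_harmonic \<mu> U. \<forall>x. 0 \<le> h x}"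

definition sup_norm :: "('a \<Rightarrow> real) \<Rightarrow> real" where
  "sup_norm h = (SUP x. \<bar>h x\<bar>)"

end

theory Submission imports Defs begin

text \<open>The Harnack inequality only applies to functions that are nonnegative on all of \<open>X\<close>.
  Given \<open>h\<close> bounded and harmonic, \<open>h\<close> minus its infimum on a sublevel set \<open>V\<^sub>k\<close> is made globally
  nonnegative by adding a combination of the harmonic functions \<open>x \<mapsto> \<mu>\<^sub>x\<^sup>W(X - V\<^sub>j)\<close>, \<open>j \<le> k\<close>, where
  \<open>W\<close> is a much smaller sublevel set, and similarly for \<open>-h\<close>. The Harnack inequality for the two
  corrected functions shrinks the oscillation of \<open>h\<close>, up to the size of the correction, which is
  small at \<open>x0\<close>, since the \<open>\<mu>\<^sub>x\<^sub>0\<close>-mass of the complements decays geometrically: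
  on leaving a small sublevel set one lands, with probability greater than \<open>\<delta>\<close>, in a region where
  the exit distribution from the next larger sublevel set is, by the Harnack inequality, comparable
  to the one at \<open>x0\<close>; only the remaining mass can jump out of the larger set at once.\<close>

section \<open>Sublevel sets, universal measurability and closure properties of bounded harmonic
  functions\<close>

lemma sublevel_mono: "s \<le> t \<Longrightarrow> sublevel X0 \<rho> s \<subseteq> sublevel X0 \<rho> t"
  by (auto simp: sublevel_def)

lemma borel_subset_universally_measurable:
  "A \<in> sets borel \<Longrightarrow> A \<in> universally_measurable_sets"
  by (auto simp: universally_measurable_sets_def finite_borel_measure_def
      intro: sets_completionI_sets)

lemma borel_measurable_univ_ext:
  assumes "finite_borel_measure M" "f \<in> borel_measurable univ_borel"
  shows "f \<in> borel_measurable (univ_ext M)"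
proof -
  have "sets (univ_ext M) = sets univ_borel"
    using assms(1) by (simp add: sets_univ_ext sets_univ_borel)
  then show ?thesis
    using assms(2) measurable_cong_sets by blast
qed

lemma space_univ_ext: "finite_borel_measure M \<Longrightarrow> space (univ_ext M) = UNIV"
  using sets_eq_imp_space_eq[of "univ_ext M" univ_borel]
  by (simp add: sets_univ_ext sets_univ_borel)

lemma bounded_harmonicI:
  assumes "h \<in> borel_measurable univ_borel" "\<And>x. \<bar>h x\<bar> \<le> B"
    and "\<And>V x. open V \<Longrightarrow> closure V \<subseteq> U \<Longrightarrow> x \<in> V \<Longrightarrow>
       integrable (univ_ext (\<mu> V x)) h \<and> (\<integral>y. h y \<partial>univ_ext (\<mu> V x)) = h x"
  shows "h \<in> bounded_harmonic \<mu> U"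
  using assms by (auto simp: bounded_harmonic_def harmonic_def bounded_iff)

lemma bounded_harmonicD:
  assumes "h \<in> bounded_harmonic \<mu> U"
  shows "h \<in> borel_measurable univ_borel" "bounded (range h)"
    and "open V \<Longrightarrow> closure V \<subseteq> U \<Longrightarrow> x \<in> V \<Longrightarrow> integrable (univ_ext (\<mu> V x)) h"
    and "open V \<Longrightarrow> closure V \<subseteq> U \<Longrightarrow> x \<in> V \<Longrightarrow> (\<integral>y. h y \<partial>univ_ext (\<mu> V x)) = h x"
  using assms by (auto simp: bounded_harmonic_def harmonic_def)

lemma bounded_harmonic_mono: "U \<subseteq> U' \<Longrightarrow> bounded_harmonic \<mu> U' \<subseteq> bounded_harmonic \<mu> U"
  unfolding bounded_harmonic_def harmonic_def by blast

lemma bounded_harmonic_add: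
  assumes "f \<in> bounded_harmonic \<mu> U" "g \<in> bounded_harmonic \<mu> U"
  shows "(\<lambda>x. f x + g x) \<in> bounded_harmonic \<mu> U"
proof -
  obtain A B where "\<And>x. \<bar>f x\<bar> \<le> A" "\<And>x. \<bar>g x\<bar> \<le> B"
    using assms[THEN bounded_harmonicD(2)] by (auto simp: bounded_iff)
  then have "\<bar>f x + g x\<bar> \<le> A + B" for x
    by (meson abs_triangle_ineq add_mono order_trans)
  then show ?thesis
    by (intro bounded_harmonicI[where B = "A + B"])
      (use assms[THEN bounded_harmonicD(1)] assms[THEN bounded_harmonicD(3)]
        assms[THEN bounded_harmonicD(4)] in \<open>auto intro!: borel_measurable_add\<close>)
qed

lemma bounded_harmonic_cmult:
  assumes "f \<in> bounded_harmonic \<mu> U"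
  shows "(\<lambda>x. c * f x) \<in> bounded_harmonic \<mu> U"
proof -
  obtain A where "\<And>x. \<bar>f x\<bar> \<le> A"
    using assms[THEN bounded_harmonicD(2)] by (auto simp: bounded_iff)
  then have "\<bar>c * f x\<bar> \<le> \<bar>c\<bar> * A" for x
    by (simp add: abs_mult mult_left_mono)
  then show ?thesis
    by (intro bounded_harmonicI[where B = "\<bar>c\<bar> * A"])
      (use assms[THEN bounded_harmonicD(1)] assms[THEN bounded_harmonicD(3)]
        assms[THEN bounded_harmonicD(4)] in \<open>auto intro!: borel_measurable_times\<close>)
qed

lemma abs_le_sup_norm: "bounded (range h) \<Longrightarrow> \<bar>h x\<bar> \<le> sup_norm h"
  unfolding sup_norm_def
  by (rule cSUP_upper) (auto simp: bounded_iff bdd_above_def)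

section \<open>Exit measures as probability measures, and the harmonic functions they
  generate\<close>

context exit_measures
begin

lemma open_sublevel: "open (sublevel X0 \<rho> t)"
proof -
  have "sublevel X0 \<rho> t = X0 \<inter> \<rho> -` {..<t}"
    by (auto simp: sublevel_def)
  then show ?thesis
    using continuous_on_open_vimage[OF open_X0] continuous_\<rho> by (metis Int_commute open_lessThan)
qed

lemma x0_in_sublevel: "0 < t \<Longrightarrow> x0 \<in> sublevel X0 \<rho> t"
  by (simp add: sublevel_def x0_in \<rho>_x0)

lemma sublevel_in_local_open_sets:
  "0 < t \<Longrightarrow> ereal t < R \<Longrightarrow> sublevel X0 \<rho> t \<in> local_open_sets X0 \<rho> R"
  by (auto simp: local_open_sets_def open_sublevel)

lemma local_open_sets_subset:
  "U \<in> local_open_sets X0 \<rho> R \<Longrightarrow> open V \<Longrightarrow> V \<subseteq> U \<Longrightarrow> V \<in> local_open_sets X0 \<rho> R"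
  unfolding local_open_sets_def by blast

lemma emeasure_univ_ext_UNIV:
  "U \<in> local_open_sets X0 \<rho> R \<Longrightarrow> emeasure (univ_ext (\<mu> U x)) UNIV = 1"
  by (simp add: emeasure_univ_ext_borel finite_borel total_mass)

lemma prob_space_univ_ext:
  "U \<in> local_open_sets X0 \<rho> R \<Longrightarrow> prob_space (univ_ext (\<mu> U x))"
  by (intro prob_spaceI) (simp add: space_univ_ext finite_borel emeasure_univ_ext_UNIV)

lemma prob_space_exit:
  assumes "U \<in> local_open_sets X0 \<rho> R"
  shows "prob_space (\<mu> U x)"
proof -
  have "space (\<mu> U x) = UNIV"
    using finite_borel[OF assms, of x] sets_eq_imp_space_eq[of "\<mu> U x" borel]
    by (simp add: finite_borel_measure_def)
  then show ?thesis
    by (intro prob_spaceI) (simp add: total_mass assms)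
qed

lemma measure_exit_measurable:
  assumes "U \<in> local_open_sets X0 \<rho> R" "E \<in> sets borel"
  shows "(\<lambda>y. measure (\<mu> U y) E) \<in> borel_measurable univ_borel"
  unfolding measure_def using universally_measurable_kernel[OF assms] by simp

lemma measure_exit_outside:
  "U \<in> local_open_sets X0 \<rho> R \<Longrightarrow> x \<notin> U \<Longrightarrow> E \<in> sets borel \<Longrightarrow>
    measure (\<mu> U x) E = indicator E x"
  by (simp add: dirac_outside measure_return)

lemma integrable_bounded_exit:
  fixes f :: "'a \<Rightarrow> real"
  assumes "V \<in> local_open_sets X0 \<rho> R" "f \<in> borel_measurable univ_borel" "\<And>y. \<bar>f y\<bar> \<le> B"
  shows "integrable (univ_ext (\<mu> V x)) f"
proof -
  interpret prob_space "univ_ext (\<mu> V x)"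
    by (rule prob_space_univ_ext[OF assms(1)])
  show ?thesis
    by (rule integrable_const_bound[where B = B])
      (use assms borel_measurable_univ_ext[OF finite_borel] in auto)
qed

text \<open>The iteration property is assumed for \<open>emeasure\<close> and nonnegative integrals.
  Since all masses are at most one, it transfers to \<open>measure\<close> and Bochner integrals,
  the form required by \<open>harmonic\<close>.\<close>

lemma measure_exit_iterated:
  assumes "U \<in> local_open_sets X0 \<rho> R" "V \<in> local_open_sets X0 \<rho> R" "V \<subseteq> U" "E \<in> sets borel"
  shows "integrable (univ_ext (\<mu> V x)) (\<lambda>y. measure (\<mu> U y) E)"
    and "(\<integral>y. measure (\<mu> U y) E \<partial>univ_ext (\<mu> V x)) = measure (\<mu> U x) E"
proof -
  have pr: "prob_space (\<mu> U y)" for y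
    by (rule prob_space_exit[OF assms(1)])
  show int: "integrable (univ_ext (\<mu> V x)) (\<lambda>y. measure (\<mu> U y) E)"
    by (rule integrable_bounded_exit[where B = 1])
      (use assms measure_exit_measurable prob_space.prob_le_1[OF pr] in auto)
  have em: "emeasure (\<mu> U y) E = ennreal (measure (\<mu> U y) E)" for y
    by (intro finite_measure.emeasure_eq_measure prob_space.finite_measure pr)
  have "ennreal (measure (\<mu> U x) E) = (\<integral>\<^sup>+ y. emeasure (\<mu> U y) E \<partial>univ_ext (\<mu> V x))"
    by (rule trans[OF em[symmetric] iterated[OF assms]])
  also have "\<dots> = (\<integral>\<^sup>+ y. ennreal (measure (\<mu> U y) E) \<partial>univ_ext (\<mu> V x))"
    unfolding em ..
  also have "\<dots> = ennreal (\<integral>y. measure (\<mu> U y) E \<partial>univ_ext (\<mu> V x))"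
    by (rule nn_integral_eq_integral[OF int AE_I2[OF measure_nonneg]])
  finally show "(\<integral>y. measure (\<mu> U y) E \<partial>univ_ext (\<mu> V x)) = measure (\<mu> U x) E"
    by (simp add: Bochner_Integration.integral_nonneg)
qed

text \<open>An open set with closure in \<open>U\<close> is again a local open set contained in
  \<open>U\<close>, so the mean value property is the iteration property. Being nonnegative
  everywhere, these functions are admissible in the Harnack inequality.\<close>

lemma bounded_harmonic_measure_exit:
  assumes "U \<in> local_open_sets X0 \<rho> R" "E \<in> sets borel"
  shows "(\<lambda>y. measure (\<mu> U y) E) \<in> bounded_harmonic \<mu> U"
proof (rule bounded_harmonicI[where B = 1])
  show "\<bar>measure (\<mu> U x) E\<bar> \<le> 1" for x
    by (simp add: prob_space.prob_le_1 prob_space_exit assms)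
  show "integrable (univ_ext (\<mu> V x)) (\<lambda>y. measure (\<mu> U y) E) \<and>
      (\<integral>y. measure (\<mu> U y) E \<partial>univ_ext (\<mu> V x)) = measure (\<mu> U x) E"
    if "open V" "closure V \<subseteq> U" for V x
    using measure_exit_iterated[OF assms(1) local_open_sets_subset[OF assms(1)] _ assms(2)] that
    by (meson closure_subset order_trans)
qed (rule measure_exit_measurable[OF assms])

lemma bounded_harmonic_const:
  assumes "U \<in> local_open_sets X0 \<rho> R"
  shows "(\<lambda>_. c) \<in> bounded_harmonic \<mu> U"
proof -
  have "prob_space (univ_ext (\<mu> V x))" if "open V" "closure V \<subseteq> U" for V x
    using that local_open_sets_subset[OF assms] closure_subset
    by (intro prob_space_univ_ext) blast
  then show ?thesis
    by (intro bounded_harmonicI[where B = "\<bar>c\<bar>"])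
      (auto simp: prob_space.prob_space prob_space_def intro: finite_measure.integrable_const)
qed

lemma bounded_harmonic_sum:
  assumes "U \<in> local_open_sets X0 \<rho> R" "finite J" "\<And>j. j \<in> J \<Longrightarrow> f j \<in> bounded_harmonic \<mu> U"
  shows "(\<lambda>x. \<Sum>j\<in>J. f j x) \<in> bounded_harmonic \<mu> U"
  using assms(2,3)
proof (induction J)
  case empty
  show ?case
    using bounded_harmonic_const[OF assms(1), of 0] by simp
next
  case (insert j J)
  then show ?case
    using bounded_harmonic_add[of "f j" \<mu> U "\<lambda>x. \<Sum>j\<in>J. f j x"] by simp
qed

end

section \<open>Geometric decay of the mass escaping from small sublevel sets\<close>

text \<open>Fixes the constants once: \<open>a\<close>, \<open>\<delta>\<close> come from the jump
  condition and \<open>b\<close>, \<open>K\<close> from the Harnack inequality, uniformly in the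
  radius.\<close>

locale harnack_exit_measures = exit_measures +
  fixes a \<delta> b K :: real
  assumes a: "0 < a" "a < 1" and \<delta>: "0 < \<delta>" "\<delta> < 1"
    and jump: "\<And>t. 0 < t \<Longrightarrow> ereal t < R \<Longrightarrow>
        \<delta> < measure (\<mu> (sublevel X0 \<rho> (a * t)) x0) (sublevel X0 \<rho> t)"
    and b: "0 < b" "b < 1" and K: "1 \<le> K"
    and SUP_le_INF: "\<And>t h. 0 < t \<Longrightarrow> ereal t < R \<Longrightarrow>
        h \<in> pos_bounded_harmonic \<mu> (sublevel X0 \<rho> t) \<Longrightarrow>
        (SUP x\<in>sublevel X0 \<rho> (b * t). h x) \<le> K * (INF x\<in>sublevel X0 \<rho> (b * t). h x)"
begin

text \<open>Real \<open>SUP\<close> and \<open>INF\<close> are informative only for bounded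
  families; boundedness of \<open>h\<close> allows the passage to a comparison of two
  points.\<close>

lemma harnack:
  assumes t: "0 < t" "ereal t < R" and h: "h \<in> bounded_harmonic \<mu> (sublevel X0 \<rho> t)" "\<And>x. 0 \<le> h x"
    and xy: "x \<in> sublevel X0 \<rho> (b * t)" "y \<in> sublevel X0 \<rho> (b * t)"
  shows "h x \<le> K * h y"
proof -
  let ?S = "sublevel X0 \<rho> (b * t)"
  obtain B where B: "\<And>x. \<bar>h x\<bar> \<le> B"
    using h(1)[THEN bounded_harmonicD(2)] by (auto simp: bounded_iff)
  have "h x \<le> (SUP x\<in>?S. h x)"
    using B xy by (intro cSUP_upper) (auto simp: bdd_above_def intro: abs_le_D1)
  also have "\<dots> \<le> K * (INF x\<in>?S. h x)"
    using SUP_le_INF[OF t] h by (simp add: pos_bounded_harmonic_def)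
  also have "\<dots> \<le> K * h y"
    using h(2) xy K by (intro mult_left_mono cINF_lower) (auto simp: bdd_below_def)
  finally show ?thesis .
qed

definition \<eta> :: real where "\<eta> = 1 - \<delta> / K"

lemma \<eta>: "0 < \<eta>" "\<eta> < 1"
proof -
  have "\<delta> / K \<le> \<delta>"
    using \<delta> K by (simp add: divide_le_eq)
  then show "0 < \<eta>" "\<eta> < 1"
    using \<delta> K by (auto simp: \<eta>_def)
qed

text \<open>Integrating \<open>measure (\<mu> U y) E\<close> over \<open>y\<close> against the exit
  measure of the inner set at \<open>x0\<close> returns its value \<open>c\<close> at
  \<open>x0\<close>. The integrand is one on \<open>E\<close>, where the measures are Dirac, and at
  least \<open>c / K\<close> on the sublevel set of radius \<open>b * t\<close>, by Harnack. The
  latter set has mass at least \<open>\<delta>\<close>, so at most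
  \<open>c - c * \<delta> / K\<close> is left for \<open>E\<close>.\<close>

lemma exit_decay_step:
  assumes t: "0 < t" "ereal t < R" and E: "E \<in> sets borel" "E \<inter> sublevel X0 \<rho> t = {}"
  shows "measure (\<mu> (sublevel X0 \<rho> (a * b * t)) x0) E \<le> \<eta> * measure (\<mu> (sublevel X0 \<rho> t) x0) E"
proof -
  let ?U = "sublevel X0 \<rho> t" and ?V = "sublevel X0 \<rho> (a * b * t)" and ?S = "sublevel X0 \<rho> (b * t)"
  define c where "c = measure (\<mu> ?U x0) E"
  have bt: "b * t \<le> t" and abt: "a * b * t \<le> b * t"
    using a b t by (auto simp: mult_left_le_one_le mult_le_cancel_right)
  then have lt: "ereal (b * t) < R" "ereal (a * b * t) < R"
    using t(2) by (meson ereal_less_eq(3) order_le_less_trans order_trans)+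
  have U: "?U \<in> local_open_sets X0 \<rho> R" and V: "?V \<in> local_open_sets X0 \<rho> R"
    using a b t lt by (auto intro!: sublevel_in_local_open_sets)
  have sub: "?V \<subseteq> ?U" "?S \<subseteq> ?U"
    using bt abt by (intro sublevel_mono; linarith)+
  have S: "?S \<in> sets borel"
    using open_sublevel by auto
  interpret V: prob_space "univ_ext (\<mu> ?V x0)"
    by (rule prob_space_univ_ext[OF V])
  note fin = finite_borel[OF V, of x0]
  have msr: "measure (univ_ext (\<mu> ?V x0)) A = measure (\<mu> ?V x0) A" if "A \<in> sets borel" for A
    using that by (simp add: measure_def emeasure_univ_ext_borel fin)
  have um: "A \<in> sets (univ_ext (\<mu> ?V x0))" if "A \<in> sets borel" for A
    using that by (simp add: sets_univ_ext fin borel_subset_universally_measurable)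
  have low: "indicator E y + c / K * indicator ?S y \<le> measure (\<mu> ?U y) E" for y
  proof (cases "y \<in> ?S")
    case True
    have "c \<le> K * measure (\<mu> ?U y) E"
      unfolding c_def
      by (rule harnack[OF t bounded_harmonic_measure_exit[OF U E(1)]])
        (use True x0_in_sublevel[of "b * t"] b t in auto)
    then show ?thesis
      using True sub E(2) K by (auto simp: indicator_def divide_le_eq mult.commute)
  next
    case False
    then show ?thesis
      using E measure_exit_outside[OF U _ E(1), of y] by (cases "y \<in> ?U") (auto simp: indicator_def)
  qed
  have "measure (\<mu> ?V x0) E + c / K * measure (\<mu> ?V x0) ?S =
      (\<integral>y. indicator E y + c / K * indicator ?S y \<partial>univ_ext (\<mu> ?V x0))"
    using um[OF S] um[OF E(1)] by (simp add: msr S E(1) V.emeasure_eq_measure)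
  also have "\<dots> \<le> (\<integral>y. measure (\<mu> ?U y) E \<partial>univ_ext (\<mu> ?V x0))"
    by (rule integral_mono)
      (use um[OF S] um[OF E(1)] low measure_exit_iterated[OF U V sub(1) E(1)]
        in \<open>auto simp: V.emeasure_eq_measure\<close>)
  also have "\<dots> = c"
    unfolding c_def by (rule measure_exit_iterated[OF U V sub(1) E(1)])
  finally have *: "measure (\<mu> ?V x0) E + c / K * measure (\<mu> ?V x0) ?S \<le> c" .
  \<comment> \<open>The jump condition is used at radius \<open>b * t\<close>, so that its target is
    exactly the set on which Harnack holds.\<close>
  have "\<delta> \<le> measure (\<mu> ?V x0) ?S"
    using jump[of "b * t"] b t lt by (simp add: mult.assoc)
  then have "c / K * \<delta> \<le> c / K * measure (\<mu> ?V x0) ?S"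
    using K by (intro mult_left_mono) (auto simp: c_def)
  then show ?thesis
    using * by (simp add: \<eta>_def c_def[symmetric] algebra_simps)
qed

text \<open>Each shrinking of the radius by \<open>a * b\<close> gains a factor
  \<open>\<eta>\<close>; the complement of the fixed outer set stays disjoint from all smaller
  sublevel sets, so the step can be iterated.\<close>

lemma exit_decay:
  assumes t: "0 < t" "ereal t < R"
  shows "measure (\<mu> (sublevel X0 \<rho> ((a * b) ^ n * t)) x0) (- sublevel X0 \<rho> t) \<le> \<eta> ^ n"
proof (induction n)
  case 0
  show ?case
    by (simp add: prob_space.prob_le_1 prob_space_exit sublevel_in_local_open_sets t)
next
  case (Suc n)
  let ?s = "(a * b) ^ n * t" and ?E = "- sublevel X0 \<rho> t"
  have "(a * b) ^ n \<le> 1"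
    using a b by (intro power_le_one) (auto simp: mult_le_one)
  then have le: "?s \<le> t"
    using t by (simp add: mult_left_le_one_le)
  have "?E \<in> sets borel"
    using open_sublevel by (auto intro!: borel_closed)
  moreover have "?E \<inter> sublevel X0 \<rho> ?s = {}"
    using sublevel_mono[OF le, of X0 \<rho>] by blast
  moreover have "0 < ?s" "ereal ?s < R"
    using a b t le order_le_less_trans[of "ereal ?s" "ereal t" R] by auto
  ultimately have "measure (\<mu> (sublevel X0 \<rho> (a * b * ?s)) x0) ?E
      \<le> \<eta> * measure (\<mu> (sublevel X0 \<rho> ?s) x0) ?E"
    by (intro exit_decay_step)
  also have "\<dots> \<le> \<eta> * \<eta> ^ n"
    using Suc \<eta> by (intro mult_left_mono) auto
  finally show ?case
    by (simp add: mult.assoc)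
qed

section \<open>Decay of the oscillation along a geometric sequence of radii\<close>

text \<open>Harnack without error terms would contract the oscillation by
  \<open>(K - 1) / (K + 1)\<close>; the surplus \<open>1 / (K + 1)\<close> is reserved for the
  corrections.\<close>

definition s :: real where "s = K / (K + 1)"

lemma s: "1 / 2 \<le> s" "s < 1"
  using K by (auto simp: s_def field_simps)

text \<open>\<open>N\<close> steps make the correction small, and the additional factor in
  \<open>q\<close> leaves room for a Harnack comparison. With \<open>1 / 2 \<le> s\<close>, the
  constant 8 yields both \<open>4 * K\<^sup>2 * \<eta> ^ N \<le> s\<close> and
  \<open>\<eta> ^ Suc N \<le> s / 2\<close>.\<close>

context
  fixes N :: nat and q :: real
  assumes \<eta>_power: "\<eta> ^ N \<le> 1 / (8 * K\<^sup>2)"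
    and q_eq: "q = (a * b) ^ Suc N"
begin

lemma q: "0 < q" "q < 1"
proof -
  have "0 < a * b" "a * b < 1"
    using a b mult_strict_mono[of a 1 b 1] by auto
  then show "0 < q" "q < 1"
    unfolding q_eq using power_Suc_less_one[of "a * b" N] by auto
qed

text \<open>The exit mass has to decay faster than \<open>s\<close> per scale: the spare factor
  \<open>1 / 2\<close> makes the contributions of all scales summable independently of
  \<open>k\<close>.\<close>

lemma \<eta>_power_le: "\<eta> ^ Suc N \<le> s / 2"
proof -
  have "1 \<le> K\<^sup>2"
    using K by simp
  then have "1 / (8 * K\<^sup>2) \<le> 1 / 8"
    using K by (simp add: divide_le_eq)
  moreover have "\<eta> ^ Suc N \<le> \<eta> ^ N"
    using \<eta> by (simp add: mult_left_le_one_le)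
  ultimately show ?thesis
    using \<eta>_power s(1) by linarith
qed

text \<open>Adding a nonnegative harmonic \<open>g\<close> that dominates the negative part of
  \<open>f\<close> makes Harnack applicable. The additive error bounds \<open>K * g y\<close>, while
  \<open>g x\<close> is simply dropped.\<close>

lemma harnack_corrected:
  assumes r: "0 < r" "ereal r < R" and "0 \<le> c"
    and f: "f \<in> bounded_harmonic \<mu> (sublevel X0 \<rho> (q ^ k * r))"
    and f_nonneg: "\<And>y. y \<in> sublevel X0 \<rho> (q ^ k * r) \<Longrightarrow> 0 \<le> f y"
    and f_lower: "\<And>y. y \<notin> sublevel X0 \<rho> (q ^ k * r) \<Longrightarrow>
        \<exists>j\<le>k. y \<notin> sublevel X0 \<rho> (q ^ j * r) \<and> - (c * s ^ j) \<le> f y"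
    and x: "x \<in> sublevel X0 \<rho> (q ^ Suc k * r)" and y: "y \<in> sublevel X0 \<rho> (q ^ Suc k * r)"
  shows "f x \<le> K * f y + 2 * K\<^sup>2 * c * \<eta> ^ N * s ^ k"
proof -
  \<comment> \<open>\<open>W\<close> lies \<open>N\<close> factors \<open>a * b\<close> inside
    \<open>V k\<close>, so that even the summand \<open>j = k\<close> of \<open>g\<close> is small
    at \<open>x0\<close>. The last factor of \<open>q\<close> brings \<open>x\<close> and
    \<open>y\<close> within radius \<open>b * t\<close>.\<close>
  define t where "t = (a * b) ^ N * (q ^ k * r)"
  define W where "W = sublevel X0 \<rho> t"
  define V where "V j = sublevel X0 \<rho> (q ^ j * r)" for j
  define g where "g z = (\<Sum>j\<le>k. c * s ^ j * measure (\<mu> W z) (- V j))" for z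
  have ab: "0 < a * b" "(a * b) ^ N \<le> 1"
    using a b by (auto intro!: power_le_one mult_le_one)
  have qk: "0 < q ^ j * r" "q ^ j * r \<le> r" for j
    using q r by (auto simp: mult_left_le_one_le power_le_one)
  have "0 < t" "t \<le> q ^ k * r"
    using ab qk[of k] a b unfolding t_def by (auto simp: mult_left_le_one_le)
  moreover have ltR: "ereal z < R" if "z \<le> r" for z
    using that r(2) order_le_less_trans[of "ereal z" "ereal r" R] by auto
  ultimately have t: "0 < t" "ereal t < R" and WV: "W \<subseteq> V k"
    using qk[of k] by (auto simp: W_def V_def intro!: sublevel_mono)
  have W: "W \<in> local_open_sets X0 \<rho> R"
    unfolding W_def by (rule sublevel_in_local_open_sets[OF t])
  have E: "- V j \<in> sets borel" for j
    using open_sublevel by (auto simp: V_def intro!: borel_closed)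
  have g: "g \<in> bounded_harmonic \<mu> W"
    unfolding g_def
    by (intro bounded_harmonic_sum[OF W] bounded_harmonic_cmult
        bounded_harmonic_measure_exit[OF W E]) auto
  have g_nonneg: "0 \<le> g z" for z
    using \<open>0 \<le> c\<close> s unfolding g_def by (intro sum_nonneg) auto
  have nonneg: "0 \<le> f z + g z" for z
  proof (cases "z \<in> V k")
    case True
    then show ?thesis
      using f_nonneg g_nonneg by (auto simp: V_def)
  next
    case False
    then obtain j where j: "j \<le> k" "z \<notin> V j" "- (c * s ^ j) \<le> f z"
      using f_lower by (auto simp: V_def)
    \<comment> \<open>Since \<open>z\<close> is outside \<open>W\<close>, its exit measure is Dirac,
      and the single summand \<open>j\<close> already compensates the lower bound of
      \<open>f\<close>.\<close>
    have "c * s ^ j = c * s ^ j * measure (\<mu> W z) (- V j)"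
      using j measure_exit_outside[OF W _ E, of z j] False WV by (auto simp: subset_iff indicator_def)
    also have "\<dots> \<le> g z"
      unfolding g_def using \<open>0 \<le> c\<close> s j by (intro member_le_sum) auto
    finally show ?thesis
      using j by linarith
  qed
  have "q ^ Suc k * r = a * b * t"
    by (simp add: t_def q_eq mult_ac)
  also have "\<dots> \<le> b * t"
    using a b t by (auto simp: mult_le_cancel_right)
  finally have xy: "x \<in> sublevel X0 \<rho> (b * t)" "y \<in> sublevel X0 \<rho> (b * t)"
    using x y sublevel_mono[of "q ^ Suc k * r" "b * t" X0 \<rho>] by auto
  have fW: "f \<in> bounded_harmonic \<mu> W"
    using f bounded_harmonic_mono[OF WV] by (auto simp: V_def)
  have 1: "f x + g x \<le> K * (f y + g y)"
    by (rule harnack[OF t _ nonneg xy]) (use bounded_harmonic_add[OF fW g] in \<open>simp add: W_def\<close>)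
  \<comment> \<open>The decay of the exit mass is known at \<open>x0\<close> only; Harnack for
    \<open>g\<close> itself transports it to \<open>y\<close>.\<close>
  have 2: "g y \<le> K * g x0"
    by (rule harnack[OF t _ g_nonneg xy(2)]) (use g x0_in_sublevel b t in \<open>auto simp: W_def\<close>)
  have "c * s ^ j * measure (\<mu> W x0) (- V j) \<le> c * \<eta> ^ N * s ^ k * (1 / 2) ^ (k - j)"
    if "j \<le> k" for j
  proof -
    \<comment> \<open>Passing from radius \<open>q ^ j * r\<close> to \<open>t\<close> takes
      \<open>N + Suc N * (k - j)\<close> factors \<open>a * b\<close>, each worth one factor
      \<open>\<eta>\<close>.\<close>
    have "q ^ k = q ^ (k - j) * q ^ j"
      using that by (simp flip: power_add)
    moreover have "q ^ (k - j) = (a * b) ^ (Suc N * (k - j))"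
      by (simp only: q_eq power_mult)
    ultimately have "t = (a * b) ^ (N + Suc N * (k - j)) * (q ^ j * r)"
      by (simp only: t_def power_add mult.assoc)
    then have "measure (\<mu> W x0) (- V j) \<le> \<eta> ^ (N + Suc N * (k - j))"
      using exit_decay[of "q ^ j * r" "N + Suc N * (k - j)"] qk[of j] ltR
      by (simp add: W_def V_def)
    also have "\<dots> = \<eta> ^ N * (\<eta> ^ Suc N) ^ (k - j)"
      by (simp only: power_add power_mult)
    also have "\<dots> \<le> \<eta> ^ N * (s / 2) ^ (k - j)"
      using \<eta>_power_le \<eta> by (intro mult_left_mono power_mono) auto
    finally have "c * s ^ j * measure (\<mu> W x0) (- V j) \<le> c * s ^ j * (\<eta> ^ N * (s / 2) ^ (k - j))"
      using \<open>0 \<le> c\<close> s by (intro mult_left_mono) auto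
    also have "\<dots> = c * \<eta> ^ N * (s ^ j * s ^ (k - j)) * (1 / 2) ^ (k - j)"
      by (simp add: power_divide)
    also have "s ^ j * s ^ (k - j) = s ^ k"
      using that by (simp flip: power_add)
    finally show ?thesis .
  qed
  then have "g x0 \<le> (\<Sum>j\<le>k. c * \<eta> ^ N * s ^ k * (1 / 2) ^ (k - j))"
    unfolding g_def by (intro sum_mono) auto
  also have "\<dots> = c * \<eta> ^ N * s ^ k * (\<Sum>j\<le>k. (1 / 2) ^ (k - j))"
    by (simp add: sum_distrib_left)
  also have "(\<Sum>j\<le>k. (1 / 2 :: real) ^ (k - j)) = (\<Sum>j\<le>k. (1 / 2) ^ j)"
    by (rule sum.reindex_bij_witness[where i = "\<lambda>j. k - j" and j = "\<lambda>j. k - j"]) auto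
  also have "(\<Sum>j\<le>k. (1 / 2 :: real) ^ j) \<le> 2"
    using sum_gp_basic[of "1 / 2 :: real" k] by simp
  finally have "g x0 \<le> c * \<eta> ^ N * s ^ k * 2"
    using \<open>0 \<le> c\<close> s \<eta> by (simp add: mult_left_mono)
  then have "g y \<le> K * (c * \<eta> ^ N * s ^ k * 2)"
    using 2 K by (meson mult_left_mono order_trans zero_le_one)
  then have "K * g y \<le> K * (K * (c * \<eta> ^ N * s ^ k * 2))"
    using K by (intro mult_left_mono) auto
  then show ?thesis
    using 1 g_nonneg[of x] by (simp add: power2_eq_square algebra_simps)
qed

text \<open>The induction is strong because the lower bounds off the current sublevel set, needed
  for the corrected Harnack inequality, use the estimate at every earlier scale.\<close>

lemma oscillation:
  assumes r: "0 < r" "ereal r < R" and h: "h \<in> bounded_harmonic \<mu> (sublevel X0 \<rho> r)"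
    and B: "\<And>x. \<bar>h x\<bar> \<le> B"
  shows "x \<in> sublevel X0 \<rho> (q ^ k * r) \<Longrightarrow> y \<in> sublevel X0 \<rho> (q ^ k * r) \<Longrightarrow>
    h x - h y \<le> 2 * B * s ^ k"
proof (induction k arbitrary: x y rule: less_induct)
  case (less k)
  show ?case
  proof (cases k)
    case 0
    then show ?thesis
      using B[of x] B[of y] by simp
  next
    case (Suc n)
    define V where "V j = sublevel X0 \<rho> (q ^ j * r)" for j
    have IH: "h x - h y \<le> 2 * B * s ^ j" if "j \<le> n" "x \<in> V j" "y \<in> V j" for j x y
      using less.IH[of j x y] that Suc by (simp add: V_def)
    \<comment> \<open>The division by \<open>s\<close> absorbs an index shift: a point first missed
      by \<open>V j\<close> still lies in \<open>V (j - 1)\<close>, where the oscillation is at most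
      \<open>2 * B * s ^ (j - 1) = c * s ^ j\<close>.\<close>
    define c where "c = 2 * B / s"
    have "0 \<le> B"
      using B[of x] by linarith
    then have c: "0 \<le> c"
      using s by (simp add: c_def)
    have qn: "0 < q ^ j * r" for j
      using q r by simp
    have bdd: "bdd_above (h ` V n)" "bdd_below (h ` V n)"
      using B by (auto simp: abs_le_iff minus_le_iff intro!: bdd_aboveI2[of _ _ B] bdd_belowI2[of _ "- B"])
    have x0: "x0 \<in> V j" for j
      unfolding V_def by (rule x0_in_sublevel[OF qn])
    define m where "m = (INF z\<in>V n. h z)"
    define M where "M = (SUP z\<in>V n. h z)"
    have m: "m \<le> h z" and M: "h z \<le> M" if "z \<in> V n" for z
      using that bdd by (auto simp: m_def M_def intro: cINF_lower cSUP_upper)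
    have osc: "M - m \<le> 2 * B * s ^ n"
    proof -
      have "M \<le> h z + 2 * B * s ^ n" if "z \<in> V n" for z
        unfolding M_def using IH[OF order_refl _ that] x0
        by (intro cSUP_least) (auto simp: algebra_simps)
      then have "M - 2 * B * s ^ n \<le> m"
        unfolding m_def using x0 by (intro cINF_greatest) (auto simp: algebra_simps)
      then show ?thesis
        by simp
    qed
    have dist: "\<exists>j\<le>n. z \<notin> V j \<and> \<bar>h z - h x0\<bar> \<le> c * s ^ j" if "z \<notin> V n" for z
    proof -
      define j where "j = (LEAST j. z \<notin> V j)"
      have j: "z \<notin> V j" "j \<le> n"
        unfolding j_def using that by (rule LeastI, rule Least_le)
      have "\<bar>h z - h x0\<bar> \<le> c * s ^ j"
      proof (cases j)
        case 0
        \<comment> \<open>Off \<open>V 0\<close> there is no previous scale, and the global bound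
          \<open>2 * B\<close> has to suffice.\<close>
        have "2 * B * s \<le> 2 * B"
          using s \<open>0 \<le> B\<close> by (simp add: mult_left_le)
        then have "2 * B \<le> c"
          using s by (simp add: c_def field_simps)
        then show ?thesis
          using B[of z] B[of x0] 0 by simp
      next
        case (Suc i)
        then have "z \<in> V i"
          using not_less_Least[of i "\<lambda>j. z \<notin> V j"] by (auto simp: j_def)
        then have "\<bar>h z - h x0\<bar> \<le> 2 * B * s ^ i"
          using IH[of i z x0] IH[of i x0 z] x0 Suc j by (simp add: abs_le_iff)
        then show ?thesis
          using s Suc by (simp add: c_def)
      qed
      then show ?thesis
        using j by blast
    qed
    have "q ^ n * r \<le> r"
      using q r by (simp add: mult_left_le_one_le power_le_one)
    then have hV: "h \<in> bounded_harmonic \<mu> (V n)"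
      using h bounded_harmonic_mono[OF sublevel_mono, of _ r] unfolding V_def by blast
    have Vn: "V n \<in> local_open_sets X0 \<rho> R"
      unfolding V_def using qn r(2) \<open>q ^ n * r \<le> r\<close>
      by (intro sublevel_in_local_open_sets) (auto intro: order_le_less_trans[of _ "ereal r"])
    define e where "e = 2 * K\<^sup>2 * c * \<eta> ^ N * s ^ n"
    \<comment> \<open>Off \<open>V n\<close> the required lower bound follows from
      \<open>dist\<close>, because \<open>m \<le> h x0\<close>.\<close>
    have "(h x + - m) \<le> K * (h y + - m) + e"
      unfolding e_def
    proof (rule harnack_corrected[OF r c])
      show "(\<lambda>z. h z + - m) \<in> bounded_harmonic \<mu> (sublevel X0 \<rho> (q ^ n * r))"
        using bounded_harmonic_add[OF hV bounded_harmonic_const[OF Vn]] by (simp only: V_def)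
      show "0 \<le> h z + - m" if "z \<in> sublevel X0 \<rho> (q ^ n * r)" for z
        using m that by (simp add: V_def)
      show "\<exists>j\<le>n. z \<notin> sublevel X0 \<rho> (q ^ j * r) \<and> - (c * s ^ j) \<le> h z + - m"
        if "z \<notin> sublevel X0 \<rho> (q ^ n * r)" for z
        using dist[of z] that m[OF x0] unfolding V_def by (smt (verit))
    qed (use less.prems Suc in simp_all)
    \<comment> \<open>The same for the distance to the supremum, with \<open>x\<close> and
      \<open>y\<close> exchanged so that the sum of both inequalities isolates
      \<open>h x - h y\<close>.\<close>
    moreover have "(- 1 * h y + M) \<le> K * (- 1 * h x + M) + e"
      unfolding e_def
    proof (rule harnack_corrected[OF r c])
      show "(\<lambda>z. - 1 * h z + M) \<in> bounded_harmonic \<mu> (sublevel X0 \<rho> (q ^ n * r))"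
        using bounded_harmonic_add[OF bounded_harmonic_cmult[OF hV] bounded_harmonic_const[OF Vn]]
        by (simp only: V_def)
      show "0 \<le> - 1 * h z + M" if "z \<in> sublevel X0 \<rho> (q ^ n * r)" for z
        using M that by (simp add: V_def)
      show "\<exists>j\<le>n. z \<notin> sublevel X0 \<rho> (q ^ j * r) \<and> - (c * s ^ j) \<le> - 1 * h z + M"
        if "z \<notin> sublevel X0 \<rho> (q ^ n * r)" for z
        using dist[of z] that M[OF x0] unfolding V_def by (smt (verit))
    qed (use less.prems Suc in simp_all)
    ultimately have *: "(K + 1) * (h x - h y) \<le> (K - 1) * (M - m) + 2 * e"
      by (simp add: algebra_simps)
    have "(K - 1) * (M - m) \<le> (K - 1) * (2 * B * s ^ n)"
      using osc K by (intro mult_left_mono) auto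
    \<comment> \<open>The error may use up one full copy of the oscillation bound, turning the
      factor \<open>K - 1\<close> into \<open>K\<close>.\<close>
    moreover have "2 * e \<le> 2 * B * s ^ n"
    proof -
      have "4 * K\<^sup>2 * \<eta> ^ N \<le> s"
        using \<eta>_power s K by (simp add: field_simps)
      then have "(4 * K\<^sup>2 * \<eta> ^ N) * (2 * B * s ^ n / s) \<le> s * (2 * B * s ^ n / s)"
        using s \<open>0 \<le> B\<close> by (intro mult_right_mono) auto
      then show ?thesis
        using s by (simp add: e_def c_def field_simps)
    qed
    ultimately have "(K + 1) * (h x - h y) \<le> K * (2 * B * s ^ n)"
      using * by (simp add: algebra_simps)
    then have "h x - h y \<le> K * (2 * B * s ^ n) / (K + 1)"
      using K by (simp add: field_simps)
    then show ?thesis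
      by (simp add: Suc s_def mult_ac)
  qed
qed

section \<open>From oscillation decay to the Hoelder estimate at \<open>x0\<close>\<close>

lemma hoelder_estimate:
  assumes r: "0 < r" "ereal r < R" and h: "h \<in> bounded_harmonic \<mu> (sublevel X0 \<rho> r)"
    and x: "x \<in> sublevel X0 \<rho> r" and \<beta>: "0 < \<beta>" "s \<le> q powr \<beta>"
  shows "\<bar>h x - h x0\<bar> \<le> 2 / s * sup_norm h * (\<rho> x / r) powr \<beta>"
proof -
  have B: "\<bar>h z\<bar> \<le> sup_norm h" for z
    by (rule abs_le_sup_norm[OF bounded_harmonicD(2)[OF h]])
  have B0: "0 \<le> sup_norm h"
    using B[of x] by linarith
  have osc: "\<bar>h x - h x0\<bar> \<le> 2 * sup_norm h * s ^ k" if "\<rho> x < q ^ k * r" for k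
  proof -
    have "x \<in> sublevel X0 \<rho> (q ^ k * r)" "x0 \<in> sublevel X0 \<rho> (q ^ k * r)"
      using that x q r by (auto simp: sublevel_def x0_in \<rho>_x0)
    then show ?thesis
      using oscillation[OF r h B] by (simp add: abs_le_iff)
  qed
  have \<rho>x: "0 \<le> \<rho> x" "\<rho> x < r"
    using x \<rho>_nonneg by (auto simp: sublevel_def)
  show ?thesis
  proof (cases "\<rho> x = 0")
    case True
    \<comment> \<open>Such an \<open>x\<close> may differ from \<open>x0\<close>, but it lies in all
      the sublevel sets, which forces \<open>h x = h x0\<close>. This matches the right-hand side,
      as \<open>0 powr \<beta> = 0\<close>.\<close>
    have "(\<lambda>k. 2 * sup_norm h * s ^ k) \<longlonglongrightarrow> 2 * sup_norm h * 0"
      using s by (intro tendsto_intros LIMSEQ_power_zero) auto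
    then have "\<bar>h x - h x0\<bar> \<le> 2 * sup_norm h * 0"
      using osc q r True by (intro LIMSEQ_le_const) auto
    then show ?thesis
      using True by simp
  next
    case False
    have "(\<lambda>k. q ^ k) \<longlonglongrightarrow> 0"
      using q by (intro LIMSEQ_power_zero) auto
    then have "\<forall>\<^sub>F k in sequentially. q ^ k < \<rho> x / r"
      using False \<rho>x r by (intro order_tendstoD(2)) auto
    then have ex: "\<exists>k. q ^ k \<le> \<rho> x / r"
      by (auto simp: eventually_sequentially intro: less_imp_le)
    \<comment> \<open>With \<open>n = Suc k\<close>, the ratio \<open>\<rho> x / r\<close> lies
      between \<open>q ^ Suc k\<close> and \<open>q ^ k\<close>. The oscillation bound holds at
      scale \<open>k\<close> and the comparison of powers at \<open>Suc k\<close>; the lost scale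
      explains the \<open>1 / s\<close> in the constant.\<close>
    define n where "n = (LEAST k. q ^ k \<le> \<rho> x / r)"
    have n: "q ^ n \<le> \<rho> x / r"
      unfolding n_def by (rule LeastI_ex[OF ex])
    have "n \<noteq> 0"
      using n \<rho>x r by (auto intro!: Nat.gr0I simp: field_simps)
    then obtain k where k: "n = Suc k"
      by (cases n) auto
    have "\<rho> x / r < q ^ k"
      using not_less_Least[of k "\<lambda>k. q ^ k \<le> \<rho> x / r"] k by (auto simp: n_def)
    then have "\<bar>h x - h x0\<bar> \<le> 2 * sup_norm h * s ^ k"
      using r by (intro osc) (simp add: field_simps)
    also have "\<dots> = 2 / s * sup_norm h * s ^ Suc k"
      using s by simp
    also have "\<dots> \<le> 2 / s * sup_norm h * (\<rho> x / r) powr \<beta>"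
    proof (rule mult_left_mono)
      have "s ^ Suc k \<le> (q powr \<beta>) ^ Suc k"
        using s \<beta> by (intro power_mono) auto
      also have "\<dots> = (q ^ Suc k) powr \<beta>"
        using q by (simp add: powr_power powr_powr powr_realpow[symmetric] mult_ac del: power_Suc)
      also have "\<dots> \<le> (\<rho> x / r) powr \<beta>"
        using n k q \<beta> by (intro powr_mono2) auto
      finally show "s ^ Suc k \<le> (\<rho> x / r) powr \<beta>" .
    qed (use s B0 in auto)
    finally show ?thesis .
  qed
qed

end

lemma hoelder:
  "\<exists>C \<beta> :: real. C > 0 \<and> 0 < \<beta> \<and> \<beta> < 1 \<and>
      (\<forall>r h x. 0 < r \<and> ereal r < R \<and> h \<in> bounded_harmonic \<mu> (sublevel X0 \<rho> r) \<and>
          x \<in> sublevel X0 \<rho> r \<longrightarrow>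
        \<bar>h x - h x0\<bar> \<le> C * sup_norm h * (\<rho> x / r) powr \<beta>)"
proof -
  have "(\<lambda>N. \<eta> ^ N) \<longlonglongrightarrow> 0"
    using \<eta> by (intro LIMSEQ_power_zero) auto
  then have "\<forall>\<^sub>F N in sequentially. \<eta> ^ N < 1 / (8 * K\<^sup>2)"
    using K by (intro order_tendstoD(2)) auto
  then obtain N where N: "\<eta> ^ N \<le> 1 / (8 * K\<^sup>2)"
    by (auto simp: eventually_sequentially intro: less_imp_le)
  define q where "q = (a * b) ^ Suc N"
  note q = q[OF N q_def]
  \<comment> \<open>As \<open>ln q\<close> is negative, \<open>s \<le> q powr \<beta>\<close> means
    \<open>\<beta> \<le> ln s / ln q\<close>; the minimum with \<open>1 / 2\<close> ensures
    \<open>\<beta> < 1\<close>.\<close>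
  define \<beta> where "\<beta> = min (1 / 2) (ln s / ln q)"
  have \<beta>: "0 < \<beta>" "\<beta> < 1"
    using s q by (auto simp: \<beta>_def divide_neg_neg)
  have "ln s \<le> \<beta> * ln q"
    using q by (auto simp: \<beta>_def min_def field_simps)
  then have "exp (ln s) \<le> exp (\<beta> * ln q)"
    by simp
  then have "s \<le> q powr \<beta>"
    using s q by (simp add: powr_def)
  then have "\<bar>h x - h x0\<bar> \<le> 2 / s * sup_norm h * (\<rho> x / r) powr \<beta>"
    if "0 < r" "ereal r < R" "h \<in> bounded_harmonic \<mu> (sublevel X0 \<rho> r)" "x \<in> sublevel X0 \<rho> r"
    for r h x
    using hoelder_estimate[OF N q_def] that \<beta> by blast
  then show ?thesis
    using \<beta> s by (intro exI[of _ "2 / s"] exI[of _ \<beta>]) auto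
qed

end

theorem corollary3p2:
  fixes X0 :: "'a::topological_space set"
    and x0 :: 'a
    and \<rho>0 :: "'a \<Rightarrow> real"
    and R0 :: ereal
    and \<mu> :: "'a set \<Rightarrow> 'a \<Rightarrow> 'a measure"
  assumes data: "exit_measures X0 x0 \<rho>0 R0 \<mu>"
    and J0: "\<exists>\<alpha> \<delta>0 :: real. 0 < \<alpha> \<and> \<alpha> < 1 \<and> 0 < \<delta>0 \<and> \<delta>0 < 1 \<and>
      (\<forall>r. 0 < r \<and> ereal r < R0 \<longrightarrow>
        measure (\<mu> (sublevel X0 \<rho>0 (\<alpha> * r)) x0) (sublevel X0 \<rho>0 r) > \<delta>0)"
    and HI: "\<exists>\<alpha> K :: real. 0 < \<alpha> \<and> \<alpha> < 1 \<and> K \<ge> 1 \<and>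
      (\<forall>r h. 0 < r \<and> ereal r < R0 \<and> h \<in> pos_bounded_harmonic \<mu> (sublevel X0 \<rho>0 r) \<longrightarrow>
        (SUP x\<in>sublevel X0 \<rho>0 (\<alpha> * r). h x) \<le> K * (INF x\<in>sublevel X0 \<rho>0 (\<alpha> * r). h x))"
  shows "\<exists>C \<beta> :: real. C > 0 \<and> 0 < \<beta> \<and> \<beta> < 1 \<and>
      (\<forall>r h x. 0 < r \<and> ereal r < R0 \<and> h \<in> bounded_harmonic \<mu> (sublevel X0 \<rho>0 r) \<and>
          x \<in> sublevel X0 \<rho>0 r \<longrightarrow>
        \<bar>h x - h x0\<bar> \<le> C * sup_norm h * (\<rho>0 x / r) powr \<beta>)"
proof -
  obtain a \<delta> where J: "0 < a" "a < 1" "0 < \<delta>" "\<delta> < 1"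
    "\<And>r. 0 < r \<Longrightarrow> ereal r < R0 \<Longrightarrow>
        \<delta> < measure (\<mu> (sublevel X0 \<rho>0 (a * r)) x0) (sublevel X0 \<rho>0 r)"
    using J0 by blast
  obtain b K where H: "0 < b" "b < 1" "1 \<le> K"
    "\<And>r h. 0 < r \<Longrightarrow> ereal r < R0 \<Longrightarrow> h \<in> pos_bounded_harmonic \<mu> (sublevel X0 \<rho>0 r) \<Longrightarrow>
        (SUP x\<in>sublevel X0 \<rho>0 (b * r). h x) \<le> K * (INF x\<in>sublevel X0 \<rho>0 (b * r). h x)"
    using HI by blast
  have "harnack_exit_measures X0 x0 \<rho>0 R0 \<mu> a \<delta> b K"
    using data J H by (simp add: harnack_exit_measures_def harnack_exit_measures_axioms_def)
  then show ?thesis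
    by (rule harnack_exit_measures.hoelder)
qed

end
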